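(* For each integer $m\ge 2$ there exists a family of instances of the online allocation model (with full compatibility and product-specific bonus functions) with $m$ products, parameterized by $p\in(0,1)$, such that $$\lim_{p\to 0}\frac{\mathrm{OPT}_{\mathrm{on}}(p)}{\mathbb E_p[U(L)]}=\frac{\binom{m-1}{\lfloor (m-1)/2\rfloor}}{2^{m-1}}\ \sim\ \sqrt{\frac{2}{\pi(m-1)}}\qquad(\text{asymptotics as } m\to\infty),$$ where $\mathrm{OPT}_{\mathrm{on}}(p)$ and $\mathbb E_p[U(L)]$ denote, respectively, the optimal online value and the expected offline benchmark for the instance with parameter $p$. In particular, this limiting ratio converges to $0$ as $m\to\infty$.
   Context: Model. An instance consists of products $\mathcal I=\{1,\dots,m\}$, capacities $b_i\in\mathbb Z_+$, base rewards $r_i\ge 0$, bonus functions $f_i:\mathbb Z_+\to\mathbb R_+$ that are nonnegative and nondecreasing with $f_i(0)=0$ (possibly different across products), a horizon of $T$ periods and arrival probabilities $p_1,\dots,p_T\in[0,1]$. In period $t$ a customer arrives with probability $p_t$, independently across periods; $L$ is the total number of arrivals. Each arriving customer must be immediately and irrevocably assigned to a product with remaining capacity or rejected; every customer may be assigned to every product (full compatibility). The $k$-th sale of product $i$ yields reward $r_i+f_i(k)$, so $n$ sales yield $R_i(n)=n r_i+\sum_{k=1}^n f_i(k)$, $R_i(0)=0$. An online algorithm $\pi$ knows all parameters of the instance, but its decision in each period depends only on the arrivals observed so far, its past decisions and internal randomization independent of the arrivals. $\mathrm{Rev}^\pi$ is its random total reward and $\mathrm{OPT}_{\mathrm{on}}=\sup_\pi\mathbb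 E[\mathrm{Rev}^\pi]$ over all online algorithms. Offline benchmark: $U(\ell)=\max\{\sum_{i\in\mathcal I}R_i(x_i): \boldsymbol x\in\mathbb Z_+^m,\ x_i\le b_i\ \forall i,\ \sum_i x_i\le \ell\}$ for $\ell\in\mathbb Z_+$. *)

theory Defs
  imports "HOL-Probability.Probability" "HOL-Probability.Product_PMF"
    "HOL-Library.Landau_Symbols"
begin

record alloc_instance =
  num_products :: nat
  capacity :: "nat \<Rightarrow> nat"
  base_reward :: "nat \<Rightarrow> real"
  bonus :: "nat \<Rightarrow> nat \<Rightarrow> real"
  horizon :: nat
  arrival_prob :: "nat \<Rightarrow> real"

abbreviation products :: "alloc_instance \<Rightarrow> nat set" where
  "products I \<equiv> {1..num_products I}"

abbreviation periods :: "alloc_instance \<Rightarrow> nat set" where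
  "periods I \<equiv> {1..horizon I}"

definition valid_instance :: "alloc_instance \<Rightarrow> bool" where
  "valid_instance I \<longleftrightarrow>
     (\<forall>i\<in>products I. 0 \<le> base_reward I i \<and> (\<forall>n. 0 \<le> bonus I i n) \<and>
        mono (bonus I i) \<and> bonus I i 0 = 0) \<and>
     (\<forall>t\<in>periods I. 0 \<le> arrival_prob I t \<and> arrival_prob I t \<le> 1)"

definition product_reward :: "alloc_instance \<Rightarrow> nat \<Rightarrow> nat \<Rightarrow> real" where
  "product_reward I i n = real n * base_reward I i + (\<Sum>k=1..n. bonus I i k)"


text \<open>An arrival pattern is a function \<open>a\<close> on periods; only its values on
  \<open>periods I\<close> matter (outside, it is \<open>False\<close> almost surely).\<close>

definition arrivals :: "alloc_instance \<Rightarrow> (nat \<Rightarrow> bool) pmf" where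
  "arrivals I = Pi_pmf (periods I) False (\<lambda>t. bernoulli_pmf (arrival_prob I t))"

definition num_arrivals :: "alloc_instance \<Rightarrow> (nat \<Rightarrow> bool) \<Rightarrow> nat" where
  "num_arrivals I a = card {t \<in> periods I. a t}"


definition offline_value :: "alloc_instance \<Rightarrow> nat \<Rightarrow> real" where
  "offline_value I l =
     Max {\<Sum>i\<in>products I. product_reward I i (x i) | x.
            x \<in> (\<Pi>\<^sub>E i\<in>products I. {..capacity I i}) \<and> (\<Sum>i\<in>products I. x i) \<le> l}"

definition expected_offline :: "alloc_instance \<Rightarrow> real" where
  "expected_offline I =
     measure_pmf.expectation (arrivals I) (\<lambda>a. offline_value I (num_arrivals I a))"


text \<open>For a fixed seed, a decision rule maps the arrival indicators of periods \<open>1..t\<close>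
  (the current one included) and the decisions of periods \<open>1..t - 1\<close> to the decision of
  period \<open>t\<close>: \<open>Some i\<close> assigns the customer to product \<open>i\<close>, \<open>None\<close> rejects. The rule is
  consulted only when a customer arrives; a period without arrival is recorded as \<open>None\<close>.\<close>

type_synonym decision_rule = "bool list \<Rightarrow> nat option list \<Rightarrow> nat option"

fun decisions :: "decision_rule \<Rightarrow> (nat \<Rightarrow> bool) \<Rightarrow> nat \<Rightarrow> nat option list" where
  "decisions d a 0 = []"
| "decisions d a (Suc t) =
     decisions d a t @ [if a (Suc t) then d (map a [1..<Suc (Suc t)]) (decisions d a t) else None]"

definition feasible_rule :: "alloc_instance \<Rightarrow> decision_rule \<Rightarrow> bool" where
  "feasible_rule I d \<longleftrightarrow>
     (\<forall>a t i. t < horizon I \<and> decisions d a (Suc t) = decisions d a t @ [Some i] \<longrightarrow>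
        i \<in> products I \<and> count_list (decisions d a t) (Some i) < capacity I i)"

definition revenue :: "alloc_instance \<Rightarrow> decision_rule \<Rightarrow> (nat \<Rightarrow> bool) \<Rightarrow> real" where
  "revenue I d a =
     (\<Sum>i\<in>products I. product_reward I i (count_list (decisions d a (horizon I)) (Some i)))"

text \<open>Internal randomization is a seed \<open>\<omega>\<close> drawn from an arbitrary probability space \<open>M\<close> on
  the reals. Only finitely many histories and actions are relevant, so restricting seeds to
  real numbers loses no generality. The product measure in \<open>expected_revenue\<close> makes the seed
  independent of the arrivals.\<close>

definition online_algorithm ::
    "alloc_instance \<Rightarrow> real measure \<Rightarrow> (real \<Rightarrow> decision_rule) \<Rightarrow> bool" where
  "online_algorithm I M \<pi> \<longleftrightarrow>
     prob_space M \<and>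
     (\<forall>h ds. (\<lambda>\<omega>. \<pi> \<omega> h ds) \<in> measurable M (count_space UNIV)) \<and>
     (\<forall>\<omega>\<in>space M. feasible_rule I (\<pi> \<omega>))"

definition expected_revenue ::
    "alloc_instance \<Rightarrow> real measure \<Rightarrow> (real \<Rightarrow> decision_rule) \<Rightarrow> real" where
  "expected_revenue I M \<pi> =
     (\<integral>z. revenue I (\<pi> (fst z)) (snd z) \<partial>(M \<Otimes>\<^sub>M measure_pmf (arrivals I)))"

definition opt_online :: "alloc_instance \<Rightarrow> real" where
  "opt_online I = Sup {expected_revenue I M \<pi> | M \<pi>. online_algorithm I M \<pi>}"

end

(* With n = m - 1, product i needs exactly i sales and is then worth (1/p)^(i-1); the first customer
   arrives surely and each of the n further periods has an arrival with probability p. The event of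
   k + 1 arrivals has probability about (n choose k) p^k, and offline it is worth about (1/p)^k by
   completing product k + 1, so the benchmark tends to the sum of all (n choose k), i.e. 2^n.
   Online, the assignment of the first customer commits to a single product: any other product j
   that is completed needs more than j arrivals, which costs a factor p. So only the largest binomial
   coefficient can be earned. *)
theory Submission
  imports Defs "HOL-Real_Asymp.Real_Asymp"
begin

section \<open>The instance and its rewards\<close>

text \<open>Bonuses must be nondecreasing, so a prize for the \<open>i\<close>-th sale persists for
  later sales; capacity \<open>i\<close> cuts those off and leaves one paying sale. The sure arrival
  in period 1 forces a decision that is the same for all arrival patterns.\<close>

definition ladder :: "nat \<Rightarrow> real \<Rightarrow> alloc_instance" where
  "ladder n p = \<lparr>num_products = Suc n, capacity = (\<lambda>i. i), base_reward = (\<lambda>_. 0),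
     bonus = (\<lambda>i k. if 1 \<le> i \<and> i \<le> k then (1 / p) ^ (i - 1) else 0),
     horizon = Suc n, arrival_prob = (\<lambda>t. if t = 1 then 1 else p)\<rparr>"

lemma ladder_sel [simp]:
  "num_products (ladder n p) = Suc n" "capacity (ladder n p) i = i"
  "horizon (ladder n p) = Suc n"
  by (simp_all add: ladder_def)

lemma valid_ladder: "0 < p \<Longrightarrow> p < 1 \<Longrightarrow> valid_instance (ladder n p)"
  by (auto simp: valid_instance_def ladder_def mono_def)

lemma product_reward_ladder:
  assumes "1 \<le> i" "x \<le> i"
  shows "product_reward (ladder n p) i x = (if x = i then (1 / p) ^ (i - 1) else 0)"
proof -
  have "(\<Sum>k=1..x. if 1 \<le> i \<and> i \<le> k then (1 / p) ^ (i - 1) else 0)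
      = (\<Sum>k=1..x. if k = i then (1 / p) ^ (i - 1) else 0)"
    using assms by (intro sum.cong) auto
  then show ?thesis
    using assms by (auto simp: product_reward_def ladder_def)
qed

lemma product_reward_ladder_nonneg: "0 < p \<Longrightarrow> 0 \<le> product_reward (ladder n p) i x"
  by (auto simp: product_reward_def ladder_def intro!: sum_nonneg)

text \<open>The completed products other than the \<open>Suc k\<close>-th have size at most \<open>k\<close>, so each of them
  is worth at most \<open>(1 / p) ^ (k - 1)\<close>.\<close>

lemma total_reward_ladder_le:
  assumes p: "0 < p" "p < 1"
    and x: "\<And>j. j \<in> {1..Suc n} \<Longrightarrow> x j \<le> j" "(\<Sum>j\<in>{1..Suc n}. x j) \<le> Suc k" "k \<le> n"
  shows "(\<Sum>j\<in>{1..Suc n}. product_reward (ladder n p) j (x j))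
    \<le> (1 / p) ^ k * (of_bool (x (Suc k) = Suc k) + real (Suc n) * p)"
proof -
  \<comment> \<open>The slack \<open>p\<close> is granted to every product, including those that
    earn nothing, so that it sums to \<open>real (Suc n) * p\<close>.\<close>
  have "product_reward (ladder n p) j (x j)
      \<le> (1 / p) ^ k * ((if j = Suc k then of_bool (x (Suc k) = Suc k) else 0) + p)"
    if j: "j \<in> {1..Suc n}" for j
  proof (cases "x j = j")
    case False
    then show ?thesis
      using j p x(1)[OF j] by (simp add: product_reward_ladder)
  next
    case True
    have "x j \<le> (\<Sum>j\<in>{1..Suc n}. x j)"
      using j by (intro member_le_sum) auto
    then have le: "j \<le> Suc k"
      using x(2) True by simp
    show ?thesis
    proof (cases "j = Suc k")
      case True
      then show ?thesis
        using \<open>x j = j\<close> j p by (simp add: product_reward_ladder algebra_simps)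
    next
      case False
      then obtain k' where k': "k = Suc k'" "j - 1 \<le> k'"
        using le j by (cases k) auto
      have "(1 / p) ^ (j - 1) \<le> (1 / p) ^ k'"
        using p k' by (intro power_increasing) auto
      also have "\<dots> = (1 / p) ^ k * p"
        using p k' by simp
      finally show ?thesis
        using True False j by (simp add: product_reward_ladder)
    qed
  qed
  then have "(\<Sum>j\<in>{1..Suc n}. product_reward (ladder n p) j (x j))
      \<le> (\<Sum>j\<in>{1..Suc n}. (1 / p) ^ k * ((if j = Suc k then of_bool (x (Suc k) = Suc k) else 0) + p))"
    by (rule sum_mono)
  also have "\<dots> = (1 / p) ^ k *
      ((\<Sum>j\<in>{1..Suc n}. if j = Suc k then of_bool (x (Suc k) = Suc k) else 0) + real (Suc n) * p)"
    by (simp add: sum_distrib_left [symmetric] sum.distrib del: sum.cl_ivl_Suc)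
  also have "(\<Sum>j\<in>{1..Suc n}. if j = Suc k then of_bool (x (Suc k) = Suc k) else (0::real))
      = of_bool (x (Suc k) = Suc k)"
    using x(3) by (subst sum.delta) auto
  finally show ?thesis .
qed

text \<open>Giving all customers to product \<open>Suc k\<close> already earns
  \<open>(1 / p) ^ k\<close>, and all the other products together add only a relative error of order
  \<open>p\<close>. The two bounds thus agree in the limit.\<close>

lemma offline_value_ladder:
  assumes p: "0 < p" "p < 1" and k: "k \<le> n"
  shows "offline_value (ladder n p) (Suc k) \<le> (1 / p) ^ k * (1 + real (Suc n) * p)"
    and "(1 / p) ^ k \<le> offline_value (ladder n p) (Suc k)"
proof -
  let ?X = "{x. x \<in> (\<Pi>\<^sub>E i\<in>products (ladder n p). {..capacity (ladder n p) i})
    \<and> (\<Sum>i\<in>products (ladder n p). x i) \<le> Suc k}"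
  let ?f = "\<lambda>x. \<Sum>i\<in>products (ladder n p). product_reward (ladder n p) i (x i)"
  have eq: "offline_value (ladder n p) (Suc k) = Max (?f ` ?X)"
    unfolding offline_value_def by (rule arg_cong[where f = Max]) auto
  have "?X \<subseteq> (\<Pi>\<^sub>E i\<in>products (ladder n p). {..capacity (ladder n p) i})"
    by blast
  then have fin: "finite (?f ` ?X)"
    by (intro finite_imageI) (erule finite_subset, intro finite_PiE, auto)
  \<comment> \<open>All \<open>Suc k\<close> customers go to product \<open>Suc k\<close>; the
    function is restricted because members of the extensional product are \<open>undefined\<close>
    outside the index set.\<close>
  define y where "y = (\<lambda>i\<in>{1..Suc n}. if i = Suc k then Suc k else 0)"
  have "(\<Sum>i\<in>{1..Suc n}. y i) = (\<Sum>i\<in>{1..Suc n}. if i = Suc k then Suc k else 0)"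
    unfolding y_def by (intro sum.cong) auto
  also have "\<dots> = Suc k"
    using k by (subst sum.delta) auto
  finally have yX: "y \<in> ?X"
    unfolding mem_Collect_eq by (auto simp: y_def simp del: sum.cl_ivl_Suc)
  have "?f x \<le> (1 / p) ^ k * (1 + real (Suc n) * p)" if "x \<in> ?X" for x
  proof -
    have "?f x \<le> (1 / p) ^ k * (of_bool (x (Suc k) = Suc k) + real (Suc n) * p)"
      unfolding ladder_sel using that k p
      by (intro total_reward_ladder_le) (auto simp del: sum.cl_ivl_Suc simp: PiE_iff)
    also have "\<dots> \<le> (1 / p) ^ k * (1 + real (Suc n) * p)"
      using p by (intro mult_left_mono add_right_mono) auto
    finally show ?thesis .
  qed
  then show "offline_value (ladder n p) (Suc k) \<le> (1 / p) ^ k * (1 + real (Suc n) * p)"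
    unfolding eq using fin yX by (subst Max_le_iff) auto
  have "(1 / p) ^ k = product_reward (ladder n p) (Suc k) (y (Suc k))"
    using k by (simp add: y_def product_reward_ladder)
  also have "\<dots> \<le> ?f y"
    using k p by (intro member_le_sum) (auto intro: product_reward_ladder_nonneg)
  also have "\<dots> \<le> Max (?f ` ?X)"
    using fin yX by (intro Max_ge) auto
  finally show "(1 / p) ^ k \<le> offline_value (ladder n p) (Suc k)"
    unfolding eq .
qed

section \<open>Distribution of the number of arrivals\<close>

lemma finite_set_arrivals: "finite (set_pmf (arrivals I))"
  unfolding arrivals_def by (subst set_Pi_pmf) (auto intro!: finite_PiE_dflt)

lemma bernoulli_pmf_1: "bernoulli_pmf 1 = return_pmf True"
proof (rule pmf_eqI)
  show "pmf (bernoulli_pmf 1) b = pmf (return_pmf True) b" for b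
    by (cases b) simp_all
qed

lemma set_arrivals_ladder:
  assumes "a \<in> set_pmf (arrivals (ladder n p))"
  shows "a 1"
proof -
  have "a 1 \<in> set_pmf (bernoulli_pmf (arrival_prob (ladder n p) 1))"
    using assms by (auto simp: arrivals_def set_Pi_pmf PiE_dflt_def)
  then show ?thesis
    by (simp add: ladder_def bernoulli_pmf_1)
qed

text \<open>Period 1 is split off: its sure arrival accounts for \<open>Suc\<close>, and the other
  \<open>n\<close> periods are independent with the same probability \<open>p\<close>.\<close>

lemma num_arrivals_ladder:
  assumes p: "0 \<le> p" "p \<le> 1"
  shows "map_pmf (num_arrivals (ladder n p)) (arrivals (ladder n p))
    = map_pmf Suc (binomial_pmf n p)"
proof -
  have ins: "{1..Suc n} = insert 1 {2..Suc n}"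
    by auto
  let ?P = "Pi_pmf {2..Suc n} False (\<lambda>_. bernoulli_pmf p)"
  have "arrivals (ladder n p) = map_pmf (\<lambda>(y,f). f(1 := y))
      (pair_pmf (bernoulli_pmf 1) (Pi_pmf {2..Suc n} False
        (\<lambda>t. bernoulli_pmf (arrival_prob (ladder n p) t))))"
    unfolding arrivals_def ladder_sel ins
    by (subst Pi_pmf_insert) (auto simp: ladder_def)
  also have "Pi_pmf {2..Suc n} False (\<lambda>t. bernoulli_pmf (arrival_prob (ladder n p) t)) = ?P"
    by (intro Pi_pmf_cong) (auto simp: ladder_def)
  finally have "arrivals (ladder n p) = map_pmf (\<lambda>f. f(1 := True)) ?P"
    by (simp add: bernoulli_pmf_1 pair_return_pmf1 map_pmf_comp fun_upd_def)
  then have "map_pmf (num_arrivals (ladder n p)) (arrivals (ladder n p))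
      = map_pmf (\<lambda>f. num_arrivals (ladder n p) (f(1 := True))) ?P"
    by (simp add: map_pmf_comp)
  also have "(\<lambda>f. num_arrivals (ladder n p) (f(1 := True)))
      = (\<lambda>f. Suc (card {t \<in> {2..Suc n}. f t}))"
  proof
    fix f :: "nat \<Rightarrow> bool"
    have "{t \<in> {1..Suc n}. (f(1 := True)) t} = insert 1 {t \<in> {2..Suc n}. f t}"
      by auto
    then show "num_arrivals (ladder n p) (f(1 := True)) = Suc (card {t \<in> {2..Suc n}. f t})"
      by (simp add: num_arrivals_def)
  qed
  also have "map_pmf \<dots> ?P = map_pmf Suc (map_pmf (\<lambda>f. card {t \<in> {2..Suc n}. f t}) ?P)"
    by (simp add: map_pmf_comp)
  also have "map_pmf (\<lambda>f. card {t \<in> {2..Suc n}. f t}) ?P = binomial_pmf n p"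
    using p by (intro binomial_pmf_altdef'[symmetric]) auto
  finally show ?thesis .
qed

text \<open>All later expectations are evaluated through this finite sum, in which
  \<open>p ^ k\<close> cancels against rewards of size \<open>(1 / p) ^ k\<close>.\<close>

lemma expectation_num_arrivals_ladder:
  fixes g :: "nat \<Rightarrow> real"
  assumes p: "0 \<le> p" "p \<le> 1"
  shows "measure_pmf.expectation (arrivals (ladder n p)) (\<lambda>a. g (num_arrivals (ladder n p) a))
    = (\<Sum>k\<le>n. real (n choose k) * p ^ k * (1 - p) ^ (n - k) * g (Suc k))"
proof -
  have "measure_pmf.expectation (arrivals (ladder n p)) (\<lambda>a. g (num_arrivals (ladder n p) a))
      = measure_pmf.expectation (map_pmf (num_arrivals (ladder n p)) (arrivals (ladder n p))) g"
    by simp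
  also have "\<dots> = measure_pmf.expectation (binomial_pmf n p) (\<lambda>k. g (Suc k))"
    by (subst num_arrivals_ladder[OF p]) simp
  also have "\<dots> = (\<Sum>k\<le>n. real (n choose k) * p ^ k * (1 - p) ^ (n - k) * g (Suc k))"
    using p by (subst expectation_binomial_pmf') auto
  finally show ?thesis .
qed

section \<open>Sales along a fixed arrival pattern\<close>

lemma card_arrivals_Suc:
  "card {s \<in> {1..Suc t}. a s} = card {s \<in> {1..t}. a s} + of_bool (a (Suc t))"
proof -
  have "{s \<in> {1..Suc t}. a s}
      = (if a (Suc t) then insert (Suc t) {s \<in> {1..t}. a s} else {s \<in> {1..t}. a s})"
    by (auto simp: le_Suc_eq)
  then show ?thesis
    by simp
qed

text \<open>Each arrival causes at most one sale, since the decision equals \<open>Some i\<close>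
  for at most one \<open>i\<close>, and a period without arrival causes none.\<close>

lemma sum_count_decisions_le:
  assumes "finite A"
  shows "(\<Sum>i\<in>A. count_list (decisions d a t) (Some i)) \<le> card {s \<in> {1..t}. a s}"
proof (induction t)
  case (Suc t)
  let ?x = "if a (Suc t) then d (map a [1..<Suc (Suc t)]) (decisions d a t) else None"
  have "(\<Sum>i\<in>A. count_list (decisions d a (Suc t)) (Some i))
      = (\<Sum>i\<in>A. count_list (decisions d a t) (Some i)) + (\<Sum>i\<in>A. of_bool (?x = Some i))"
    by (subst sum.distrib [symmetric], intro sum.cong) auto
  also have "(\<Sum>i\<in>A. of_bool (?x = Some i)) \<le> (of_bool (a (Suc t)) :: nat)"
    using assms by (cases "a (Suc t)"; cases ?x) (auto simp: of_bool_def)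
  finally show ?case
    using Suc unfolding card_arrivals_Suc by linarith
qed simp

text \<open>The decision of period 1 is \<open>d [True] []\<close>. If it is not
  \<open>Some i\<close>, the first arrival is lost to product \<open>i\<close>, and its sales stay
  behind the arrivals ever after. The index is \<open>Suc t\<close> because before period 1 both
  counts are 0.\<close>

lemma count_decisions_less:
  assumes "a 1" "d [True] [] \<noteq> Some i"
  shows "count_list (decisions d a (Suc t)) (Some i) < card {s \<in> {1..Suc t}. a s}"
proof (induction t)
  case 0
  have "{s \<in> {1..Suc 0}. a s} = {1}"
    using assms by auto
  then show ?case
    using assms by simp
next
  case (Suc t)
  then show ?case
    unfolding card_arrivals_Suc[of "Suc t"] decisions.simps(2)[of d a "Suc t"] by auto
qed

lemma count_decisions_le_capacity:
  assumes "feasible_rule I d" "t \<le> horizon I"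
  shows "count_list (decisions d a t) (Some i) \<le> capacity I i"
  using assms(2)
proof (induction t)
  case (Suc t)
  show ?case
  proof (cases "decisions d a (Suc t) = decisions d a t @ [Some i]")
    case True
    then have "count_list (decisions d a t) (Some i) < capacity I i"
      using assms(1) Suc.prems unfolding feasible_rule_def by (meson Suc_le_eq)
    then show ?thesis
      unfolding True by simp
  next
    case False
    then have "count_list (decisions d a (Suc t)) (Some i) = count_list (decisions d a t) (Some i)"
      by auto
    then show ?thesis
      using Suc by simp
  qed
qed simp

section \<open>Upper bound on the online revenue\<close>

text \<open>This is where the irrevocable commitment enters: completing product \<open>Suc k\<close>
  with exactly \<open>Suc k\<close> arrivals uses every customer, hence also the first one.\<close>

lemma revenue_ladder_le:
  assumes p: "0 < p" "p < 1" and d: "feasible_rule (ladder n p) d"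
    and a: "a 1" "num_arrivals (ladder n p) a = Suc k"
  shows "revenue (ladder n p) d a
    \<le> (1 / p) ^ k * (of_bool (d [True] [] = Some (Suc k)) + real (Suc n) * p)"
proof -
  define x where "x = (\<lambda>i. count_list (decisions d a (Suc n)) (Some i))"
  have card: "card {s \<in> {1..Suc n}. a s} = Suc k"
    using a(2) by (simp add: num_arrivals_def)
  have "card {s \<in> {1..Suc n}. a s} \<le> card {1..Suc n}"
    by (intro card_mono) auto
  then have kn: "k \<le> n"
    using card by simp
  have first: "d [True] [] = Some (Suc k)" if "x (Suc k) = Suc k"
    using count_decisions_less[of a d "Suc k" n, OF a(1)] that unfolding x_def card by auto
  have "revenue (ladder n p) d a = (\<Sum>j\<in>{1..Suc n}. product_reward (ladder n p) j (x j))"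
    unfolding revenue_def x_def ladder_sel ..
  also have "\<dots> \<le> (1 / p) ^ k * (of_bool (x (Suc k) = Suc k) + real (Suc n) * p)"
  proof (rule total_reward_ladder_le[OF p _ _ kn])
    show "x j \<le> j" for j
      using count_decisions_le_capacity[OF d, of "Suc n" a j] unfolding x_def by simp
    show "(\<Sum>j\<in>{1..Suc n}. x j) \<le> Suc k"
      unfolding x_def card[symmetric] by (rule sum_count_decisions_le) simp
  qed
  also have "\<dots> \<le> (1 / p) ^ k * (of_bool (d [True] [] = Some (Suc k)) + real (Suc n) * p)"
    using first p by (intro mult_left_mono add_right_mono) auto
  finally show ?thesis .
qed

text \<open>After cancelling \<open>p ^ k\<close> and bounding \<open>(1 - p) ^ (n - k)\<close> by
  1, the main term is a sum of binomial coefficients over those \<open>k\<close> that match the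
  first decision. At most one \<open>k\<close> does, so the largest coefficient of the row bounds
  it.\<close>

lemma expectation_revenue_ladder_le:
  assumes p: "0 < p" "p < 1" and d: "feasible_rule (ladder n p) d"
  shows "measure_pmf.expectation (arrivals (ladder n p)) (revenue (ladder n p) d)
    \<le> real (n choose (n div 2)) + 2 ^ n * (real (Suc n) * p)"
proof -
  let ?I = "ladder n p"
  define e where "e = real (Suc n) * p"
  have e: "0 \<le> e"
    using p by (simp add: e_def)
  define first where "first = (\<lambda>l. of_bool (d [True] [] = Some l) :: real)"
  \<comment> \<open>The pathwise bound as a function of the number \<open>l\<close> of arrivals,
    with \<open>k\<close> written as \<open>l - 1\<close>; the sure first arrival excludes
    \<open>l = 0\<close>.\<close>
  define g where "g = (\<lambda>l. (1 / p) ^ (l - 1) * (first l + e))"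
  have "measure_pmf.expectation (arrivals ?I) (revenue ?I d)
      \<le> measure_pmf.expectation (arrivals ?I) (\<lambda>a. g (num_arrivals ?I a))"
  proof (intro integral_mono_AE AE_pmfI integrable_measure_pmf_finite finite_set_arrivals)
    fix a assume "a \<in> set_pmf (arrivals ?I)"
    then have a: "a 1"
      by (rule set_arrivals_ladder)
    then have "1 \<in> {t \<in> periods ?I. a t}"
      by simp
    then have "num_arrivals ?I a \<noteq> 0"
      unfolding num_arrivals_def by (subst card_0_eq) auto
    then obtain k where "num_arrivals ?I a = Suc k"
      by (cases "num_arrivals ?I a") auto
    then show "revenue ?I d a \<le> g (num_arrivals ?I a)"
      using revenue_ladder_le[of p n d a k, OF p d a] by (simp add: g_def e_def first_def)
  qed
  also have "\<dots> = (\<Sum>k\<le>n. real (n choose k) * p ^ k * (1 - p) ^ (n - k) * g (Suc k))"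
    using p by (intro expectation_num_arrivals_ladder) auto
  also have "\<dots> \<le> (\<Sum>k\<le>n. real (n choose k) * (first (Suc k) + e))"
  proof (rule sum_mono)
    fix k
    have "real (n choose k) * p ^ k * (1 - p) ^ (n - k) * g (Suc k)
        = (1 - p) ^ (n - k) * (real (n choose k) * (first (Suc k) + e))"
      using p by (simp add: g_def power_divide)
    also have "\<dots> \<le> 1 * (real (n choose k) * (first (Suc k) + e))"
      using p e by (intro mult_right_mono power_le_one) (auto simp: first_def)
    finally show "real (n choose k) * p ^ k * (1 - p) ^ (n - k) * g (Suc k)
        \<le> real (n choose k) * (first (Suc k) + e)"
      by simp
  qed
  also have "\<dots> = (\<Sum>k\<le>n. real (n choose k) * first (Suc k)) + (\<Sum>k\<le>n. real (n choose k)) * e"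
    by (simp add: distrib_left sum.distrib sum_distrib_right)
  also have "(\<Sum>k\<le>n. real (n choose k)) = 2 ^ n"
    by (simp add: choose_row_sum flip: of_nat_sum)
  also have "(\<Sum>k\<le>n. real (n choose k) * first (Suc k)) \<le> real (n choose (n div 2))"
  \<comment> \<open>The first decision may also be a rejection, in which case the whole sum
    vanishes.\<close>
  proof (cases "\<exists>k\<le>n. d [True] [] = Some (Suc k)")
    case True
    then obtain k where k: "k \<le> n" "d [True] [] = Some (Suc k)"
      by blast
    have "(\<Sum>j\<le>n. real (n choose j) * first (Suc j)) = (\<Sum>j\<le>n. if j = k then real (n choose j) else 0)"
      using k by (intro sum.cong) (auto simp: first_def)
    also have "\<dots> = real (n choose k)"
      using k by simp
    finally show ?thesis
      by (simp add: binomial_maximum)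
  next
    case False
    then have "(\<Sum>j\<le>n. real (n choose j) * first (Suc j)) = 0"
      by (intro sum.neutral) (auto simp: first_def)
    then show ?thesis
      by simp
  qed
  finally show ?thesis
    by (simp add: e_def)
qed

section \<open>Randomized algorithms and deterministic rules\<close>

text \<open>By Fubini the expected revenue is an average over seeds, and each fixed seed gives a
  deterministic feasible rule. The assumption \<open>0 \<le> c\<close> serves the case of a
  non-integrable revenue, whose integral is 0 by convention.\<close>

lemma expected_revenue_le:
  assumes alg: "online_algorithm I M \<pi>" and c: "0 \<le> c"
    and le: "\<And>d. feasible_rule I d \<Longrightarrow> measure_pmf.expectation (arrivals I) (revenue I d) \<le> c"
  shows "expected_revenue I M \<pi> \<le> c"
proof (cases "integrable (M \<Otimes>\<^sub>M measure_pmf (arrivals I)) (\<lambda>z. revenue I (\<pi> (fst z)) (snd z))")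
  case True
  interpret M: prob_space M
    using alg by (simp add: online_algorithm_def)
  interpret pair_prob_space M "measure_pmf (arrivals I)"
    by unfold_locales
  have "expected_revenue I M \<pi> = (\<integral>\<omega>. (\<integral>a. revenue I (\<pi> \<omega>) a \<partial>measure_pmf (arrivals I)) \<partial>M)"
    using integral_fst'[OF True] by (simp add: expected_revenue_def)
  also have "\<dots> \<le> c"
    using integrable_fst'[OF True] alg le
    by (intro M.integral_le_const AE_I2) (auto simp: online_algorithm_def)
  finally show ?thesis .
next
  case False
  then show ?thesis
    using c by (simp add: expected_revenue_def not_integrable_integral_eq)
qed

text \<open>A point mass as seed places each feasible deterministic rule in the set whose supremum
  is \<open>opt_online\<close>.\<close>

lemma expected_revenue_deterministic:
  assumes "feasible_rule I d"
  defines "M \<equiv> measure_pmf (return_pmf (0 :: real))"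
  shows "online_algorithm I M (\<lambda>_. d)"
    and "expected_revenue I M (\<lambda>_. d) = measure_pmf.expectation (arrivals I) (revenue I d)"
proof -
  show "online_algorithm I M (\<lambda>_. d)"
    using assms by (simp add: online_algorithm_def measure_pmf.prob_space_axioms)
  interpret M: prob_space M
    unfolding M_def by (rule measure_pmf.prob_space_axioms)
  interpret pair_prob_space M "measure_pmf (arrivals I)"
    by unfold_locales
  interpret swap: pair_prob_space "measure_pmf (arrivals I)" M
    by unfold_locales
  \<comment> \<open>Integrability is clear on the finitely supported arrivals. It is pulled back
    along the first projection, with the arrivals as first factor, and the factors are swapped
    afterwards.\<close>
  have "integrable (distr (measure_pmf (arrivals I) \<Otimes>\<^sub>M M) (measure_pmf (arrivals I)) fst) (revenue I d)"
    unfolding M.distr_pair_fst by (intro integrable_measure_pmf_finite finite_set_arrivals)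
  then have "integrable (measure_pmf (arrivals I) \<Otimes>\<^sub>M M) (\<lambda>z. revenue I d (fst z))"
    by (rule integrable_distr[rotated]) simp
  from swap.integrable_product_swap[OF this]
  have "integrable (M \<Otimes>\<^sub>M measure_pmf (arrivals I)) (\<lambda>z. revenue I d (snd z))"
    by (simp add: case_prod_unfold)
  from integral_fst'[OF this]
  show "expected_revenue I M (\<lambda>_. d) = measure_pmf.expectation (arrivals I) (revenue I d)"
    by (simp add: expected_revenue_def M.prob_space)
qed

section \<open>Committing to a single product\<close>

definition dedicated_rule :: "nat \<Rightarrow> decision_rule" where
  "dedicated_rule i h ds = (if count_list ds (Some i) < i then Some i else None)"

lemma feasible_dedicated_rule:
  "i \<in> {1..Suc n} \<Longrightarrow> feasible_rule (ladder n p) (dedicated_rule i)"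
  by (auto simp: feasible_rule_def dedicated_rule_def split: if_splits)

lemma count_decisions_dedicated_rule:
  "count_list (decisions (dedicated_rule i) a t) (Some i) = min i (card {s \<in> {1..t}. a s})"
proof (induction t)
  case (Suc t)
  then show ?case
    unfolding card_arrivals_Suc by (auto simp: dedicated_rule_def)
qed simp

text \<open>With exactly \<open>Suc k\<close> arrivals the rule completes its product and earns
  \<open>(1 / p) ^ k\<close>, which cancels the \<open>p ^ k\<close> in the probability of that
  event.\<close>

lemma expectation_revenue_dedicated_rule_ge:
  assumes p: "0 < p" "p < 1" and k: "k \<le> n"
  shows "real (n choose k) * (1 - p) ^ (n - k)
    \<le> measure_pmf.expectation (arrivals (ladder n p)) (revenue (ladder n p) (dedicated_rule (Suc k)))"
proof -
  let ?I = "ladder n p" and ?d = "dedicated_rule (Suc k)"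
  \<comment> \<open>Revenue from more than \<open>Suc k\<close> arrivals is dropped; its
    contribution is only of order \<open>p\<close>.\<close>
  define g where "g = (\<lambda>l. if l = Suc k then (1 / p) ^ k else 0)"
  have "real (n choose k) * (1 - p) ^ (n - k)
      = (\<Sum>j\<le>n. if j = k then real (n choose k) * (1 - p) ^ (n - k) else 0)"
    using k by simp
  also have "\<dots> = (\<Sum>j\<le>n. real (n choose j) * p ^ j * (1 - p) ^ (n - j) * g (Suc j))"
    using p by (intro sum.cong) (auto simp: g_def power_divide)
  also have "\<dots> = measure_pmf.expectation (arrivals ?I) (\<lambda>a. g (num_arrivals ?I a))"
    using p by (intro expectation_num_arrivals_ladder [symmetric]) auto
  also have "\<dots> \<le> measure_pmf.expectation (arrivals ?I) (revenue ?I ?d)"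
  proof (intro integral_mono_AE AE_pmfI integrable_measure_pmf_finite finite_set_arrivals)
    fix a
    let ?x = "\<lambda>i. count_list (decisions ?d a (Suc n)) (Some i)"
    have "g (num_arrivals ?I a) \<le> product_reward ?I (Suc k) (?x (Suc k))"
      using p unfolding count_decisions_dedicated_rule
      by (subst product_reward_ladder) (auto simp: g_def num_arrivals_def)
    also have "\<dots> \<le> revenue ?I ?d a"
      unfolding revenue_def ladder_sel using k p
      by (intro member_le_sum) (auto intro: product_reward_ladder_nonneg simp del: decisions.simps)
    finally show "g (num_arrivals ?I a) \<le> revenue ?I ?d a" .
  qed
  finally show ?thesis .
qed

section \<open>Bounds on the two values and the limit of their ratio\<close>

lemma opt_online_ladder:
  assumes p: "0 < p" "p < 1"
  shows "opt_online (ladder n p) \<le> real (n choose (n div 2)) + 2 ^ n * (real (Suc n) * p)"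
    and "real (n choose (n div 2)) * (1 - p) ^ (n - n div 2) \<le> opt_online (ladder n p)"
proof -
  let ?I = "ladder n p" and ?d = "dedicated_rule (Suc (n div 2))"
  let ?S = "{expected_revenue ?I M \<pi> | M \<pi>. online_algorithm ?I M \<pi>}"
  let ?c = "real (n choose (n div 2)) + 2 ^ n * (real (Suc n) * p)"
  have le: "s \<le> ?c" if "s \<in> ?S" for s
    using that p expectation_revenue_ladder_le[OF p] by (auto intro!: expected_revenue_le)
  have d: "feasible_rule ?I ?d"
    by (rule feasible_dedicated_rule) auto
  \<comment> \<open>This member shows that the set is nonempty, as \<open>cSup_least\<close>
    requires, and also provides the lower bound.\<close>
  then have mem: "measure_pmf.expectation (arrivals ?I) (revenue ?I ?d) \<in> ?S"
    using expected_revenue_deterministic[OF d] by force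
  show "opt_online ?I \<le> ?c"
    unfolding opt_online_def using le mem by (intro cSup_least) auto
  have "bdd_above ?S"
    using le by (intro bdd_aboveI) auto
  then have "measure_pmf.expectation (arrivals ?I) (revenue ?I ?d) \<le> opt_online ?I"
    unfolding opt_online_def using mem by (intro cSup_upper)
  then show "real (n choose (n div 2)) * (1 - p) ^ (n - n div 2) \<le> opt_online ?I"
    using expectation_revenue_dedicated_rule_ge[OF p, of "n div 2" n] by simp
qed

text \<open>Offline every \<open>k\<close> contributes its binomial coefficient, so \<open>c\<close>
  tends to the full row sum \<open>2 ^ n\<close> as \<open>p\<close> tends to 0.\<close>

lemma expected_offline_ladder:
  fixes p :: real and n :: nat
  assumes p: "0 < p" "p < 1"
  defines "c \<equiv> (\<Sum>k\<le>n. real (n choose k) * (1 - p) ^ (n - k))"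
  shows "expected_offline (ladder n p) \<le> c * (1 + real (Suc n) * p)"
    and "c \<le> expected_offline (ladder n p)"
proof -
  let ?U = "\<lambda>k. offline_value (ladder n p) (Suc k)"
  have eq: "expected_offline (ladder n p)
      = (\<Sum>k\<le>n. real (n choose k) * p ^ k * (1 - p) ^ (n - k) * ?U k)"
    unfolding expected_offline_def using p by (intro expectation_num_arrivals_ladder) auto
  have scale: "real (n choose k) * p ^ k * (1 - p) ^ (n - k) * ((1 / p) ^ k * y)
      = real (n choose k) * (1 - p) ^ (n - k) * y" for k y
    using p by (simp add: power_divide)
  have "expected_offline (ladder n p) \<le>
      (\<Sum>k\<le>n. real (n choose k) * p ^ k * (1 - p) ^ (n - k) * ((1 / p) ^ k * (1 + real (Suc n) * p)))"
    unfolding eq using p offline_value_ladder(1)[OF p]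
    by (intro sum_mono mult_left_mono) auto
  then show "expected_offline (ladder n p) \<le> c * (1 + real (Suc n) * p)"
    unfolding scale c_def sum_distrib_right .
  have "(\<Sum>k\<le>n. real (n choose k) * p ^ k * (1 - p) ^ (n - k) * ((1 / p) ^ k * 1))
      \<le> expected_offline (ladder n p)"
    unfolding eq using p offline_value_ladder(2)[OF p]
    by (intro sum_mono mult_left_mono) auto
  then show "c \<le> expected_offline (ladder n p)"
    unfolding scale c_def by simp
qed

lemma ladder_ratio_tendsto:
  "((\<lambda>p. opt_online (ladder n p) / expected_offline (ladder n p))
     \<longlongrightarrow> real (n choose (n div 2)) / 2 ^ n) (at_right 0)"
proof -
  define c where "c = (\<lambda>p::real. \<Sum>k\<le>n. real (n choose k) * (1 - p) ^ (n - k))"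
  have c0: "c 0 = 2 ^ n"
    by (simp add: c_def choose_row_sum flip: of_nat_sum)
  have ev: "eventually (\<lambda>p::real. 0 < p \<and> p < 1) (at_right 0)"
    using eventually_at_right_real[of 0 1] by simp
  \<comment> \<open>The bounding functions are continuous at 0, so their one-sided limits are their
    values there.\<close>
  have at0: "(f \<longlongrightarrow> f 0) (at_right 0)" if "isCont f 0" for f :: "real \<Rightarrow> real"
    using that by (simp add: isCont_def filterlim_at_split)
  have "((\<lambda>p. opt_online (ladder n p)) \<longlongrightarrow> real (n choose (n div 2))) (at_right 0)"
  proof (rule tendsto_sandwich)
    show "((\<lambda>p. real (n choose (n div 2)) * (1 - p) ^ (n - n div 2)) \<longlongrightarrow> real (n choose (n div 2)))
        (at_right 0)"
      by (rule at0[THEN tendsto_eq_rhs]) auto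
    show "((\<lambda>p. real (n choose (n div 2)) + 2 ^ n * (real (Suc n) * p)) \<longlongrightarrow> real (n choose (n div 2)))
        (at_right 0)"
      by (rule at0[THEN tendsto_eq_rhs]) auto
    show "\<forall>\<^sub>F p in at_right 0.
        real (n choose (n div 2)) * (1 - p) ^ (n - n div 2) \<le> opt_online (ladder n p)"
      using ev by eventually_elim (intro opt_online_ladder; simp)
    show "\<forall>\<^sub>F p in at_right 0.
        opt_online (ladder n p) \<le> real (n choose (n div 2)) + 2 ^ n * (real (Suc n) * p)"
      using ev by eventually_elim (intro opt_online_ladder; simp)
  qed
  moreover have "((\<lambda>p. expected_offline (ladder n p)) \<longlongrightarrow> 2 ^ n) (at_right 0)"
  proof (rule tendsto_sandwich)
    have "isCont c 0"
      unfolding c_def by (intro continuous_intros)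
    then show "(c \<longlongrightarrow> 2 ^ n) (at_right 0)"
      "((\<lambda>p. c p * (1 + real (Suc n) * p)) \<longlongrightarrow> 2 ^ n) (at_right 0)"
      by (auto intro!: at0[THEN tendsto_eq_rhs] simp: c0)
    show "\<forall>\<^sub>F p in at_right 0. c p \<le> expected_offline (ladder n p)"
      using ev unfolding c_def by eventually_elim (intro expected_offline_ladder; simp)
    show "\<forall>\<^sub>F p in at_right 0. expected_offline (ladder n p) \<le> c p * (1 + real (Suc n) * p)"
      using ev unfolding c_def by eventually_elim (intro expected_offline_ladder; simp)
  qed
  ultimately show ?thesis
    by (intro tendsto_divide) auto
qed

section \<open>Asymptotics of the largest binomial coefficient\<close>

text \<open>Makes \<open>gbinomial_asymptotic\<close> applicable to central binomial coefficients.
  Both sides are 1 at \<open>q = 0\<close> and have the ratio -(2q + 1) / (2(q + 1)) of consecutive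
  terms.\<close>

lemma gbinomial_minus_half:
  "((-1/2 :: real) gchoose q) = (-1) ^ q * real ((2 * q) choose q) / 4 ^ q"
proof (induction q)
  case (Suc q)
  have rec: "real (Suc q) * ((-1/2 :: real) gchoose Suc q) = (-1/2 - real q) * ((-1/2) gchoose q)"
    using gbinomial_absorb_comp[of "-1/2 :: real" q] gbinomial_absorption[of q "-1/2 :: real"]
    by simp
  have binom: "real (Suc q) * real ((2 * Suc q) choose Suc q) = 2 * (2 * real q + 1) * real ((2 * q) choose q)"
  proof -
    have "Suc q * ((2 * Suc q) choose Suc q) = (2 * Suc q) * (Suc (2 * q) choose q)"
      using Suc_times_binomial_eq[of "Suc (2 * q)" q] by (simp add: mult.commute)
    moreover have "Suc q * (Suc (2 * q) choose Suc q) = Suc (2 * q) * ((2 * q) choose q)"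
      using Suc_times_binomial_eq[of "2 * q" q] by (simp add: mult.commute)
    moreover have "Suc (2 * q) choose Suc q = Suc (2 * q) choose q"
      using central_binomial_odd[of "Suc (2 * q)"] by simp
    ultimately have "Suc q * ((2 * Suc q) choose Suc q) = 2 * (Suc (2 * q) * ((2 * q) choose q))"
      by (metis mult.assoc)
    then have "real (Suc q * ((2 * Suc q) choose Suc q)) = real (2 * (Suc (2 * q) * ((2 * q) choose q)))"
      by (rule arg_cong)
    then show ?thesis
      unfolding of_nat_mult by (simp del: binomial_Suc_Suc)
  qed
  have "real (Suc q) * ((-1) ^ Suc q * real ((2 * Suc q) choose Suc q) / 4 ^ Suc q)
      = (-1) ^ Suc q * (real (Suc q) * real ((2 * Suc q) choose Suc q)) / 4 ^ Suc q"
    by (simp only: times_divide_eq_right mult.left_commute)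
  also have "\<dots> = (-1/2 - real q) * ((-1) ^ q * real ((2 * q) choose q) / 4 ^ q)"
    unfolding binom by (simp add: field_simps)
  finally have "real (Suc q) * ((-1/2 :: real) gchoose Suc q)
      = real (Suc q) * ((-1) ^ Suc q * real ((2 * Suc q) choose Suc q) / 4 ^ Suc q)"
    unfolding rec Suc.IH by simp
  then show ?case
    by (simp only: mult_cancel_left of_nat_eq_0_iff nat.simps simp_thms)
qed simp

lemma central_binomial_asymp_equiv:
  "(\<lambda>q. real ((2 * q) choose q) / 4 ^ q) \<sim>[at_top] (\<lambda>q. 1 / sqrt (pi * real q))"
proof (rule asymp_equivI')
  have Gamma: "Gamma (- (-1/2 :: real)) = sqrt pi"
    using Gamma_one_half_real by simp
  \<comment> \<open>The limit given by \<open>gbinomial_asymptotic\<close> is 1 / Gamma(1/2); the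
    factor \<open>sqrt pi\<close> normalizes it to 1.\<close>
  have "(\<lambda>q. sqrt pi * (((-1/2 :: real) gchoose q) /
      ((-1) ^ q / exp ((-1/2 + 1) * of_real (ln (real q)))))) \<longlonglongrightarrow> sqrt pi * inverse (sqrt pi)"
    unfolding Gamma [symmetric] by (intro tendsto_mult tendsto_const gbinomial_asymptotic)
  then have "(\<lambda>q. sqrt pi * (((-1/2 :: real) gchoose q) /
      ((-1) ^ q / exp ((-1/2 + 1) * of_real (ln (real q)))))) \<longlonglongrightarrow> 1"
    by simp
  moreover have "eventually (\<lambda>q. sqrt pi * (((-1/2 :: real) gchoose q) /
      ((-1) ^ q / exp ((-1/2 + 1) * of_real (ln (real q)))))
      = (real ((2 * q) choose q) / 4 ^ q) / (1 / sqrt (pi * real q))) at_top"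
    using eventually_gt_at_top[of 0]
  proof eventually_elim
    case (elim q)
    then have "exp ((-1/2 + 1) * of_real (ln (real q))) = sqrt (real q)"
      by (simp add: powr_half_sqrt [symmetric] powr_def)
    then show ?case
      unfolding gbinomial_minus_half by (simp add: real_sqrt_mult)
  qed
  ultimately show "(\<lambda>q. (real ((2 * q) choose q) / 4 ^ q) / (1 / sqrt (pi * real q))) \<longlonglongrightarrow> 1"
    by (rule Lim_transform_eventually)
qed

text \<open>For odd \<open>n\<close>, Pascal's rule adds the two equal middle entries of row
  \<open>n\<close>, so the central entry of row \<open>n + 1\<close> is twice as large, and so is
  the power of 2. Both parities thus reduce to even rows.\<close>

lemma central_binomial_half:
  "real (n choose (n div 2)) / 2 ^ n
    = real ((2 * ((n + 1) div 2)) choose ((n + 1) div 2)) / 4 ^ ((n + 1) div 2)"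
proof (cases "even n")
  case True
  then obtain q where "n = 2 * q" ..
  then show ?thesis
    by (simp add: power_mult)
next
  case False
  then obtain q where n: "n = 2 * q + 1" ..
  have "n choose Suc q = n choose q"
    using central_binomial_odd[OF False] n by simp
  then have "(2 * Suc q) choose Suc q = 2 * (n choose q)"
    using n by (simp add: binomial_Suc_Suc)
  then show ?thesis
    using n by (simp add: power_mult)
qed

lemma max_binomial_asymp_equiv:
  "(\<lambda>n. real (n choose (n div 2)) / 2 ^ n) \<sim>[at_top] (\<lambda>n. sqrt (2 / (pi * real n)))"
proof -
  have lim: "filterlim (\<lambda>n::nat. (n + 1) div 2) at_top at_top"
    by (rule filterlim_compose[OF filterlim_at_top_div_const_nat filterlim_add_const_nat_at_top]) simp
  have "(\<lambda>n. real (n choose (n div 2)) / 2 ^ n)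
      \<sim>[at_top] (\<lambda>n. 1 / sqrt (pi * real ((n + 1) div 2)))"
    unfolding central_binomial_half
    by (rule asymp_equiv_compose'[OF central_binomial_asymp_equiv lim])
  also have "(\<lambda>n. 1 / sqrt (pi * real ((n + 1) div 2))) \<sim>[at_top] (\<lambda>n. sqrt (2 / (pi * real n)))"
  \<comment> \<open>Twice \<open>(n + 1) div 2\<close> is \<open>n\<close> or \<open>n + 1\<close>,
    which gives the two outer functions.\<close>
  proof (rule asymp_equiv_sandwich_real)
    show "(\<lambda>n. sqrt (2 / (pi * (real n + 1)))) \<sim>[at_top] (\<lambda>n. sqrt (2 / (pi * real n)))"
      by real_asymp
    show "(\<lambda>n::nat. sqrt (2 / (pi * real n))) \<sim>[at_top] (\<lambda>n. sqrt (2 / (pi * real n)))"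
      by simp
    show "\<forall>\<^sub>F n in at_top. 1 / sqrt (pi * real ((n + 1) div 2))
        \<in> {sqrt (2 / (pi * (real n + 1)))..sqrt (2 / (pi * real n))}"
      using eventually_gt_at_top[of 0]
    proof eventually_elim
      case (elim n)
      have bnd: "real n \<le> 2 * real ((n + 1) div 2)" "2 * real ((n + 1) div 2) \<le> real n + 1"
        by linarith+
      have "1 / sqrt (pi * real ((n + 1) div 2)) = sqrt (2 / (pi * (2 * real ((n + 1) div 2))))"
        by (simp add: real_sqrt_divide)
      moreover have "2 / (pi * (2 * real ((n + 1) div 2))) \<le> 2 / (pi * real n)"
        using bnd elim by (intro divide_left_mono mult_left_mono mult_pos_pos) auto
      moreover have "2 / (pi * (real n + 1)) \<le> 2 / (pi * (2 * real ((n + 1) div 2)))"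
        using bnd elim by (intro divide_left_mono mult_left_mono mult_pos_pos) auto
      ultimately show ?case
        by (simp only: atLeastAtMost_iff real_sqrt_le_iff)
    qed
  qed
  finally show ?thesis .
qed

theorem theorem3:
  shows "(\<forall>m::nat. m \<ge> 2 \<longrightarrow>
      (\<exists>I :: real \<Rightarrow> alloc_instance.
         (\<forall>p\<in>{0<..<1}. valid_instance (I p) \<and> num_products (I p) = m) \<and>
         ((\<lambda>p. opt_online (I p) / expected_offline (I p)) \<longlongrightarrow>
            real ((m - 1) choose ((m - 1) div 2)) / 2 ^ (m - 1)) (at_right 0)))
    \<and> (\<lambda>m::nat. real ((m - 1) choose ((m - 1) div 2)) / 2 ^ (m - 1))
        \<sim>[at_top] (\<lambda>m. sqrt (2 / (pi * (real m - 1))))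
    \<and> (\<lambda>m::nat. real ((m - 1) choose ((m - 1) div 2)) / 2 ^ (m - 1)) \<longlonglongrightarrow> 0"
    (is "?P \<and> ?f \<sim>[at_top] ?g \<and> ?Q")
proof (intro conjI)
  show ?P
  proof (intro allI impI exI conjI ballI)
    fix m :: nat and p :: real
    assume "2 \<le> m" "p \<in> {0<..<1}"
    then show "valid_instance (ladder (m - 1) p)" "num_products (ladder (m - 1) p) = m"
      by (auto simp: valid_ladder)
  qed (rule ladder_ratio_tendsto)
  have "filterlim (\<lambda>m::nat. m - 1) at_top at_top"
    by (rule filterlim_minus_const_nat_at_top)
  then have "?f \<sim>[at_top] (\<lambda>m. sqrt (2 / (pi * real (m - 1))))"
    by (rule asymp_equiv_compose'[OF max_binomial_asymp_equiv])
  \<comment> \<open>Subtraction on the naturals truncates, so \<open>real (m - 1)\<close> and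
    \<open>real m - 1\<close> agree only from \<open>m = 1\<close> on.\<close>
  also have "\<dots> \<sim>[at_top] ?g"
    by (intro asymp_equiv_refl_ev eventually_mono[OF eventually_ge_at_top[of 1]]) (simp add: of_nat_diff)
  finally show equiv: "?f \<sim>[at_top] ?g" .
  have "?g \<longlonglongrightarrow> 0"
    by real_asymp
  then show ?Q
    using equiv by (simp add: asymp_equiv_symI tendsto_asymp_equiv_cong)
qed

end
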